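(* (The $\mathfrak{m}$-core-EP decomposition.) Let $A\in\mathbb{C}_{n,n}$ with $\mathrm{Ind}(A)=k$ and $\mathrm{rk}(A^{k})=\mathrm{rk}\big((A^{k})^{\sim}A^{k}\big)=r$. Then $A$ can be written as $A=\widehat{A_1}+\widehat{A_2}$, where (i) $\mathrm{rk}(\widehat{A_1}^{2})=\mathrm{rk}(\widehat{A_1})$ and $\mathrm{rk}(\widehat{A_1})=\mathrm{rk}(\widehat{A_1}^{\sim}\widehat{A_1})$; (ii) $\widehat{A_2}^{k}=0$; (iii) $\widehat{A_1}^{\sim}\widehat{A_2}=\widehat{A_2}\widehat{A_1}=0$. Furthermore, let $U$ be a unitary matrix giving the core-EP decomposition of $A$, i.e. $A=U\begin{bmatrix}T&S\\ 0&N\end{bmatrix}U^*$ with $T\in\mathbb{C}_{r,r}$ invertible, $S\in\mathbb{C}_{r,n-r}$ and $N^k=0$, and write $U^{*}GU=\begin{bmatrix}G_1&G_2\\ G_3&G_4\end{bmatrix}$ with $G_1\in\mathbb{C}_{r,r}$. Then $\widehat{A_1}$ and $\widehat{A_2}$ have the form $$\widehat{A_1}=U\begin{bmatrix}T&S+G_1^{-1}G_2N\\ 0&0\end{bmatrix}U^*,\qquad \widehat{A_2}=U\begin{bmatrix}0&-G_1^{-1}G_2N\\ 0&N\end{bmatrix}U^*.$$ (Here one or both of $\widehat{A_1}$ and $\widehat{A_2}$ can be zero.)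
   Context: $\mathbb{C}_{n,n}$ is the set of $n\times n$ complex matrices; $A^*$ and $\mathrm{rk}(A)$ denote conjugate transpose and rank. $\mathrm{Ind}(A)$ is the smallest positive integer $k$ with $\mathrm{rk}(A^{k+1})=\mathrm{rk}(A^k)$. The Minkowski metric matrix is $G=\begin{bmatrix}1&0\\ 0&-I_{n-1}\end{bmatrix}$ and the Minkowski adjoint of $A$ is $A^{\sim}=GA^*G$. Core-EP decomposition (known): for every $A\in\mathbb{C}_{n,n}$ with $\mathrm{Ind}(A)=k$ and $\mathrm{rk}(A^k)=r$ there is a unitary $U$ with $A=U\begin{bmatrix}T&S\\ 0&N\end{bmatrix}U^{*}$, where $T\in\mathbb{C}_{r,r}$ is invertible and $N^k=0$. Blocks may be empty. Under the hypothesis $\mathrm{rk}(A^{k})=\mathrm{rk}((A^{k})^{\sim}A^{k})$ the block $G_1$ is invertible. *)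

theory Defs
  imports
    "Jordan_Normal_Form.Schur_Decomposition"
    "Jordan_Normal_Form.DL_Rank"
begin

definition mat_index :: "nat \<Rightarrow> complex mat \<Rightarrow> nat" where
  "mat_index n A =
     (LEAST k. 0 < k \<and> vec_space.rank n (A ^\<^sub>m (k + 1)) = vec_space.rank n (A ^\<^sub>m k))"

text \<open>Intended for \<open>n \<ge> 1\<close>; because of truncated subtraction the result for \<open>n = 0\<close> is a
  \<open>1 \<times> 1\<close> matrix.\<close>

definition minkowski_metric :: "nat \<Rightarrow> complex mat" where
  "minkowski_metric n =
     four_block_mat (1\<^sub>m 1) (0\<^sub>m 1 (n - 1)) (0\<^sub>m (n - 1) 1) (- 1\<^sub>m (n - 1))"

text \<open>The library constant \<open>mat_adjoint\<close> is the conjugate transpose.\<close>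

definition minkowski_adjoint :: "nat \<Rightarrow> complex mat \<Rightarrow> complex mat" where
  "minkowski_adjoint n A = minkowski_metric n * mat_adjoint A * minkowski_metric n"

definition unitary_mat :: "nat \<Rightarrow> complex mat \<Rightarrow> bool" where
  "unitary_mat n U \<longleftrightarrow>
     U \<in> carrier_mat n n \<and> mat_adjoint U * U = 1\<^sub>m n \<and> U * mat_adjoint U = 1\<^sub>m n"

definition core_EP_decomposition ::
  "nat \<Rightarrow> nat \<Rightarrow> nat \<Rightarrow> complex mat \<Rightarrow> complex mat \<Rightarrow> complex mat \<Rightarrow> complex mat \<Rightarrow> complex mat \<Rightarrow> bool"
where
  "core_EP_decomposition n k r A U T S N \<longleftrightarrow>
     unitary_mat n U \<and>
     T \<in> carrier_mat r r \<and> invertible_mat T \<and>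
     S \<in> carrier_mat r (n - r) \<and>
     N \<in> carrier_mat (n - r) (n - r) \<and> N ^\<^sub>m k = 0\<^sub>m (n - r) (n - r) \<and>
     A = U * four_block_mat T S (0\<^sub>m (n - r) r) N * mat_adjoint U"

definition m_core_EP_decomposition ::
  "nat \<Rightarrow> nat \<Rightarrow> complex mat \<Rightarrow> complex mat \<Rightarrow> complex mat \<Rightarrow> bool"
where
  "m_core_EP_decomposition n k A A1 A2 \<longleftrightarrow>
     A1 \<in> carrier_mat n n \<and> A2 \<in> carrier_mat n n \<and> A = A1 + A2 \<and>
     vec_space.rank n (A1 ^\<^sub>m 2) = vec_space.rank n A1 \<and>
     vec_space.rank n A1 = vec_space.rank n (minkowski_adjoint n A1 * A1) \<and>
     A2 ^\<^sub>m k = 0\<^sub>m n n \<and>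
     minkowski_adjoint n A1 * A2 = 0\<^sub>m n n \<and>
     A2 * A1 = 0\<^sub>m n n"

end

theory Submission
  imports Defs
begin

text \<open>Writing \<open>M = A^k\<close> and \<open>X~\<close> for the Minkowski adjoint, the rank hypothesis yields \<open>Z\<close> with
  \<open>M = Z M~ M\<close>. Then \<open>P = Z M~\<close> satisfies \<open>P P~ = P~\<close>, hence \<open>P = P~\<close>: it is the projection
  onto the range of \<open>M\<close> that is orthogonal for the Minkowski form, and \<open>A = P A + (A - P A)\<close> is a decomposition.
  Conversely, in any decomposition \<open>A1\<close> has the same range as \<open>M\<close>, so \<open>P A1 = A1\<close>, and
  \<open>A1~ A2 = 0\<close> gives \<open>P A2 = 0\<close>; therefore \<open>A1 = P A\<close>. In the basis given by \<open>U\<close>, the range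
  of \<open>M\<close> is spanned by the first \<open>r\<close> coordinates, and self-adjointness forces
  \<open>P = [1, G1^-1 G2; 0, 0]\<close>.\<close>

section \<open>Rank factorizations\<close>

context vec_space
begin

text \<open>Membership in a column space in matrix form: one coefficient vector is chosen for each
  column of \<open>X\<close>, and these vectors are the columns of \<open>Z\<close>.\<close>

lemma col_space_factor:
  assumes X: "X \<in> carrier_mat n p" and Y: "Y \<in> carrier_mat n q"
    and sub: "set (cols X) \<subseteq> span (set (cols Y))"
  shows "\<exists>Z \<in> carrier_mat q p. X = Y * Z"
proof -
  have "\<exists>z. z \<in> carrier_vec q \<and> Y *\<^sub>v z = col X j" if "j < p" for j
  proof -
    have "col X j \<in> col_space Y"
      using sub X that unfolding col_space_def by (auto simp: cols_def)
    then show ?thesis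
      using Y unfolding col_space_eq[OF Y] by auto
  qed
  then obtain z where z: "\<And>j. j < p \<Longrightarrow> z j \<in> carrier_vec q \<and> Y *\<^sub>v z j = col X j"
    by metis
  let ?Z = "mat_of_cols q (map z [0..<p])"
  have Z: "?Z \<in> carrier_mat q p"
    by (metis mat_of_cols_carrier(1) length_map length_upt minus_nat.diff_0)
  have colZ: "col ?Z j = z j" if "j < p" for j
    using z that by (subst col_mat_of_cols) auto
  have "X = Y * ?Z"
  proof (rule mat_col_eqI)
    fix j assume "j < dim_col (Y * ?Z)"
    then have j: "j < p"
      using Z by simp
    then show "col X j = col (Y * ?Z) j"
      using z[OF j] colZ[OF j] col_mult2[OF Y Z j] by simp
  qed (use X Y Z in auto)
  then show ?thesis
    using Z by blast
qed

lemma span_cols_mult: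
  assumes X: "X \<in> carrier_mat n p" and Y: "Y \<in> carrier_mat p q"
  shows "span (set (cols (X * Y))) \<subseteq> span (set (cols X))"
proof -
  have XY: "X * Y \<in> carrier_mat n q"
    using X Y by simp
  have "col_space (X * Y) \<subseteq> col_space X"
  proof
    fix v assume "v \<in> col_space (X * Y)"
    then obtain x where "x \<in> carrier_vec q" "v = (X * Y) *\<^sub>v x"
      unfolding col_space_eq[OF XY] using XY by auto
    then have "v = X *\<^sub>v (Y *\<^sub>v x)" "Y *\<^sub>v x \<in> carrier_vec p"
      using X Y by auto
    then show "v \<in> col_space X"
      unfolding col_space_eq[OF X] using X by auto
  qed
  then show ?thesis
    by (simp add: col_space_def)
qed

text \<open>Replaces the dimension of a span by the size of an actual set of vectors in the ambient
  space, which can be compared with other spans or listed as columns.\<close>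

lemma span_basis:
  assumes S: "finite S" "S \<subseteq> carrier_vec n"
  obtains B where "finite B" "B \<subseteq> carrier_vec n" "lin_indpt B" "span B = span S"
    "card B = vectorspace.dim class_ring (span_vs S)"
proof -
  have vs: "vectorspace class_ring (span_vs S)"
    using S by (simp add: span_is_subspace subspace_is_vs)
  have fd: "vectorspace.fin_dim class_ring (span_vs S)"
    using S by (simp add: fin_dim_span)
  have sub: "submodule class_ring (span S) V"
    using S by (simp add: span_is_submodule)
  obtain B where B: "finite B" "vectorspace.basis class_ring (span_vs S) B"
    using vectorspace.finite_basis_exists[OF vs fd] by blast
  have "B \<subseteq> span S"
    using B vectorspace.basis_def[OF vs] by auto
  moreover from this have "B \<subseteq> carrier_vec n"
    using S span_closed by auto
  moreover have "lin_indpt B" "span B = span S"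
    using B vectorspace.basis_def[OF vs] span_li_not_depend[OF \<open>B \<subseteq> span S\<close> sub] by auto
  moreover have "card B = vectorspace.dim class_ring (span_vs S)"
    using vectorspace.dim_basis[OF vs B] by simp
  ultimately show thesis
    using that B by blast
qed

text \<open>A basis of the smaller span stays independent in the larger one, so its size is a lower
  bound for the larger dimension; if the dimensions agree, it is a basis there too.\<close>

lemma span_dim_mono:
  assumes S: "finite S" "S \<subseteq> carrier_vec n" and T: "finite T" "T \<subseteq> carrier_vec n"
    and ST: "span S \<subseteq> span T"
  shows "vectorspace.dim class_ring (span_vs S) \<le> vectorspace.dim class_ring (span_vs T)"
    and "vectorspace.dim class_ring (span_vs S) = vectorspace.dim class_ring (span_vs T)
      \<Longrightarrow> span S = span T"
proof -
  obtain B where B: "finite B" "B \<subseteq> carrier_vec n" "lin_indpt B" "span B = span S"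
    "card B = vectorspace.dim class_ring (span_vs S)"
    using span_basis[OF S] .
  have vs: "vectorspace class_ring (span_vs T)"
    using T by (simp add: span_is_subspace subspace_is_vs)
  have fd: "vectorspace.fin_dim class_ring (span_vs T)"
    using T by (simp add: fin_dim_span)
  have sub: "submodule class_ring (span T) V"
    using T by (simp add: span_is_submodule)
  have BT: "B \<subseteq> span T"
    using in_own_span[of B] B(2,4) ST by auto
  have li: "\<not> module.lin_dep class_ring (span_vs T) B"
    using B span_li_not_depend[OF BT sub] by simp
  show "vectorspace.dim class_ring (span_vs S) \<le> vectorspace.dim class_ring (span_vs T)"
    using vectorspace.li_le_dim(2)[OF vs fd _ li] BT B by simp
  assume "vectorspace.dim class_ring (span_vs S) = vectorspace.dim class_ring (span_vs T)"
  then have "vectorspace.basis class_ring (span_vs T) B"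
    using vectorspace.dim_li_is_basis[OF vs fd B(1) _ li] BT B by simp
  then show "span S = span T"
    using B span_li_not_depend[OF BT sub] vectorspace.basis_def[OF vs] by auto
qed

lemma rank_mult_le_left:
  assumes X: "X \<in> carrier_mat n p" and Y: "Y \<in> carrier_mat p q"
  shows "rank (X * Y) \<le> rank X"
  unfolding rank_def using X Y cols_dim[of X] cols_dim[of "X * Y"]
  by (intro span_dim_mono(1) span_cols_mult[OF X Y]) auto

text \<open>Turns a rank equation into a matrix equation: the column space of \<open>X * Y\<close>
  lies in that of \<open>X\<close>, equal dimensions make them equal, and so the columns of
  \<open>X\<close> are combinations of those of \<open>X * Y\<close>.\<close>

lemma rank_mult_eq_left:
  assumes X: "X \<in> carrier_mat n p" and Y: "Y \<in> carrier_mat p q" and eq: "rank (X * Y) = rank X"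
  shows "\<exists>Z \<in> carrier_mat q p. X = X * Y * Z"
proof (rule col_space_factor[OF X])
  show XY: "X * Y \<in> carrier_mat n q"
    using X Y by simp
  have "span (set (cols (X * Y))) = span (set (cols X))"
    using X Y XY cols_dim[of X] cols_dim[of "X * Y"] eq
    by (intro span_dim_mono(2) span_cols_mult[OF X Y]) (auto simp: rank_def)
  moreover have "set (cols X) \<subseteq> span (set (cols X))"
    using X cols_dim[of X] by (intro in_own_span) auto
  ultimately show "set (cols X) \<subseteq> span (set (cols (X * Y)))"
    by simp
qed

text \<open>The columns of \<open>B\<close> are a basis of the column space of \<open>M\<close>, and
  \<open>C\<close> holds the coordinates of the columns of \<open>M\<close> in it.\<close>

lemma rank_factorization:
  assumes M: "M \<in> carrier_mat n p"
  obtains B C where "B \<in> carrier_mat n (rank M)" "C \<in> carrier_mat (rank M) p" "M = B * C"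
proof -
  have cM: "set (cols M) \<subseteq> carrier_vec n"
    using M cols_dim[of M] by auto
  obtain S where S: "finite S" "S \<subseteq> carrier_vec n" "span S = span (set (cols M))"
    "card S = rank M"
    using span_basis[OF _ cM] unfolding rank_def by (metis List.finite_set)
  \<comment> \<open>Listing the basis without repetition gives \<open>B\<close> exactly
    \<open>rank M\<close> columns.\<close>
  obtain ws where ws: "set ws = S" "distinct ws"
    using finite_distinct_list[OF S(1)] by blast
  have B: "mat_of_cols n ws \<in> carrier_mat n (rank M)"
    using ws S by (metis mat_of_cols_carrier(1) distinct_card)
  have "cols (mat_of_cols n ws) = ws"
    using ws S by (intro cols_mat_of_cols) auto
  then have "set (cols M) \<subseteq> span (set (cols (mat_of_cols n ws)))"
    using ws S in_own_span[of "set (cols M)"] cM by simp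
  from col_space_factor[OF M B this] show thesis
    using that B by blast
qed

end

section \<open>Conjugate transposes and their ranks\<close>

lemma index_mat_adjoint:
  assumes "i < dim_col A" "j < dim_row A"
  shows "mat_adjoint A $$ (i, j) = conjugate (A $$ (j, i))"
  using assms unfolding mat_adjoint_def by (simp add: mat_of_rows_index)

lemma mat_adjoint_dim [simp]:
  "dim_row (mat_adjoint A) = dim_col A" "dim_col (mat_adjoint A) = dim_row A"
  unfolding mat_adjoint_def by auto

lemma mat_adjoint_carrier [simp]: "mat_adjoint A \<in> carrier_mat q p \<longleftrightarrow> A \<in> carrier_mat p q"
  unfolding carrier_mat_def by auto

lemma mat_adjoint_adjoint [simp]: "mat_adjoint (mat_adjoint A) = A"
  by (rule eq_matI) (auto simp: index_mat_adjoint)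

lemma mat_adjoint_mult:
  fixes A B :: "'a :: conjugatable_field mat"
  assumes A: "A \<in> carrier_mat p q" and B: "B \<in> carrier_mat q r"
  shows "mat_adjoint (A * B) = mat_adjoint B * mat_adjoint A"
proof (rule eq_matI)
  fix i j assume "i < dim_row (mat_adjoint B * mat_adjoint A)"
    "j < dim_col (mat_adjoint B * mat_adjoint A)"
  then have ij: "i < r" "j < p"
    using A B by auto
  then show "mat_adjoint (A * B) $$ (i, j) = (mat_adjoint B * mat_adjoint A) $$ (i, j)"
    using A B
    by (auto simp: index_mat_adjoint scalar_prod_def sum_conjugate conjugate_dist_mul mult.commute
        intro!: sum.cong)
qed (use A B in auto)

text \<open>A factorization \<open>M = B * C\<close> through dimension \<open>rank M\<close> gives
  \<open>mat_adjoint M\<close> the left factor \<open>mat_adjoint C\<close>, which has only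
  \<open>rank M\<close> columns. The inequality is proved for all sizes, so that applying it to
  \<open>mat_adjoint M\<close> yields the converse.\<close>

lemma rank_mat_adjoint:
  fixes M :: "'a :: conjugatable_field mat"
  assumes M: "M \<in> carrier_mat n p"
  shows "vec_space.rank p (mat_adjoint M) = vec_space.rank n M"
proof -
  have le: "vec_space.rank p (mat_adjoint M) \<le> vec_space.rank n M"
    if M: "M \<in> carrier_mat n p" for n p and M :: "'a mat"
  proof -
    let ?r = "vec_space.rank n M"
    obtain B C where B: "B \<in> carrier_mat n ?r" and C: "C \<in> carrier_mat ?r p" and BC: "M = B * C"
      using vec_space.rank_factorization[OF M] .
    have "mat_adjoint M = mat_adjoint C * mat_adjoint B"
      using mat_adjoint_mult[OF B C] BC by simp
    then have "vec_space.rank p (mat_adjoint M) \<le> vec_space.rank p (mat_adjoint C)"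
      using vec_space.rank_mult_le_left[of "mat_adjoint C" p ?r "mat_adjoint B" n] B C by simp
    also have "\<dots> \<le> ?r"
      using vec_space.rank_le_nc[of "mat_adjoint C" p ?r] C by simp
    finally show ?thesis .
  qed
  show ?thesis
    using le[OF M] le[of "mat_adjoint M" p n] M by simp
qed

lemma rank_mult_le_right:
  fixes X Y :: "'a :: conjugatable_field mat"
  assumes X: "X \<in> carrier_mat n p" and Y: "Y \<in> carrier_mat p q"
  shows "vec_space.rank n (X * Y) \<le> vec_space.rank p Y"
  using vec_space.rank_mult_le_left[of "mat_adjoint Y" q p "mat_adjoint X" n] X Y
    rank_mat_adjoint[OF Y] rank_mat_adjoint[of "X * Y" n q] mat_adjoint_mult[OF X Y] by simp

text \<open>The row space counterpart of \<open>rank_mult_eq_left\<close>, obtained by passing to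
  adjoints and back.\<close>

lemma rank_mult_eq_right:
  fixes X Y :: "'a :: conjugatable_field mat"
  assumes X: "X \<in> carrier_mat n p" and Y: "Y \<in> carrier_mat p q"
    and eq: "vec_space.rank n (X * Y) = vec_space.rank p Y"
  shows "\<exists>Z \<in> carrier_mat p n. Y = Z * (X * Y)"
proof -
  have "vec_space.rank q (mat_adjoint Y * mat_adjoint X) = vec_space.rank q (mat_adjoint Y)"
    using X Y eq rank_mat_adjoint[OF Y] rank_mat_adjoint[of "X * Y" n q] mat_adjoint_mult[OF X Y]
    by simp
  then obtain Z where Z: "Z \<in> carrier_mat n p"
    and eqZ: "mat_adjoint Y = mat_adjoint Y * mat_adjoint X * Z"
    using vec_space.rank_mult_eq_left[of "mat_adjoint Y" q p "mat_adjoint X" n] X Y by auto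
  have "Y = mat_adjoint (mat_adjoint (X * Y) * Z)"
    using eqZ mat_adjoint_mult[OF X Y] by (metis mat_adjoint_adjoint)
  also have "\<dots> = mat_adjoint Z * (X * Y)"
    using X Y Z by (subst mat_adjoint_mult[of _ q n _ p]) auto
  finally show ?thesis
    using Z by (intro bexI[of _ "mat_adjoint Z"]) auto
qed

section \<open>Algebra of square matrices and the index\<close>

lemma mult_square_assoc:
  fixes A B C :: "'a :: semiring_0 mat"
  assumes "A \<in> carrier_mat n n" "B \<in> carrier_mat n n" "C \<in> carrier_mat n n"
  shows "A * B * C = A * (B * C)"
  using assms by (rule assoc_mult_mat)

lemma mult_square_carrier:
  fixes A B :: "'a :: semiring_0 mat"
  assumes "A \<in> carrier_mat n n" "B \<in> carrier_mat n n"
  shows "A * B \<in> carrier_mat n n"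
  using assms by (rule mult_carrier_mat)

lemma mat_add_diff:
  fixes A B :: "'a :: ab_group_add mat"
  assumes "A \<in> carrier_mat p q" "B \<in> carrier_mat p q"
  shows "A + (B - A) = B"
  using assms by (intro eq_matI) auto

lemma mat_add_diff_left:
  fixes A B :: "'a :: ab_group_add mat"
  assumes "A \<in> carrier_mat p q" "B \<in> carrier_mat p q"
  shows "A + B - A = B"
  using assms by (intro eq_matI) auto

lemma mat_add_uminus_cancel:
  fixes A B :: "'a :: ab_group_add mat"
  assumes "A \<in> carrier_mat p q" "B \<in> carrier_mat p q"
  shows "A + B + - B = A"
  using assms by (intro eq_matI) auto

lemma pow_mat_Suc_left:
  fixes A :: "'a :: semiring_1 mat"
  assumes A: "A \<in> carrier_mat n n"
  shows "A ^\<^sub>m Suc k = A * A ^\<^sub>m k"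
proof (induction k)
  case (Suc k)
  have "A ^\<^sub>m Suc (Suc k) = A * A ^\<^sub>m k * A"
    using Suc by (metis pow_mat.simps(2))
  then show ?case
    using A by (simp add: assoc_mult_mat[of _ n n _ n _ n])
qed (use A in simp)

text \<open>The \<open>LEAST\<close> in \<open>mat_index\<close> is meaningful only if some exponent
  qualifies. Ranks of powers never increase, and they cannot decrease strictly forever.\<close>

lemma mat_index_properties:
  assumes A: "A \<in> carrier_mat n n"
  shows "0 < mat_index n A"
    and "vec_space.rank n (A ^\<^sub>m Suc (mat_index n A)) = vec_space.rank n (A ^\<^sub>m mat_index n A)"
proof -
  let ?f = "\<lambda>k. vec_space.rank n (A ^\<^sub>m k)"
  have dec: "?f (Suc k) \<le> ?f k" for k
    using vec_space.rank_mult_le_left[of "A ^\<^sub>m k" n n A n] A by simp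
  have "\<exists>k. 0 < k \<and> ?f (k + 1) = ?f k"
  proof (rule ccontr)
    assume "\<not> ?thesis"
    \<comment> \<open>Only positive exponents compete in \<open>mat_index\<close>, so the strict
      descent starts at exponent 1.\<close>
    then have less: "?f (Suc (Suc k)) < ?f (Suc k)" for k
      using dec[of "Suc k"] by (metis Suc_eq_plus1 le_neq_implies_less zero_less_Suc)
    have "?f (Suc k) + k \<le> ?f 1" for k
    proof (induction k)
      case (Suc k)
      then show ?case
        using less[of k] by simp
    qed simp
    from this[of "Suc (?f 1)"] show False
      by simp
  qed
  from LeastI_ex[OF this]
  show "0 < mat_index n A" "?f (Suc (mat_index n A)) = ?f (mat_index n A)"
    unfolding mat_index_def by simp_all
qed

section \<open>The Minkowski adjoint\<close>

lemma minkowski_metric_carrier: "n \<ge> 1 \<Longrightarrow> minkowski_metric n \<in> carrier_mat n n"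
  unfolding minkowski_metric_def by (intro carrier_matI) simp_all

lemma minkowski_metric_index:
  assumes "n \<ge> 1" "i < n" "j < n"
  shows "minkowski_metric n $$ (i, j) = (if i = j then if i = 0 then 1 else - 1 else 0)"
  using assms unfolding minkowski_metric_def by auto

lemma minkowski_metric_adjoint:
  assumes "n \<ge> 1"
  shows "mat_adjoint (minkowski_metric n) = minkowski_metric n"
  by (rule eq_matI)
    (use assms minkowski_metric_carrier[OF assms] in
      \<open>auto simp: index_mat_adjoint minkowski_metric_index\<close>)

lemma minkowski_metric_square:
  assumes "n \<ge> 1"
  shows "minkowski_metric n * minkowski_metric n = 1\<^sub>m n"
proof -
  have "minkowski_metric n * minkowski_metric n =
    four_block_mat (1\<^sub>m 1) (0\<^sub>m 1 (n - 1)) (0\<^sub>m (n - 1) 1) (1\<^sub>m (n - 1))"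
    unfolding minkowski_metric_def
    by (subst mult_four_block_mat[of _ 1 1 _ "n - 1" _ "n - 1" _ _ 1 _ "n - 1"])
      (auto intro!: cong_four_block_mat eq_matI)
  then show ?thesis
    using assms by simp
qed

context
  fixes n :: nat
  assumes n: "n \<ge> 1"
begin

lemma minkowski_metric_cancel:
  assumes "X \<in> carrier_mat n n"
  shows "minkowski_metric n * (minkowski_metric n * X) = X"
  using assms minkowski_metric_carrier[OF n] minkowski_metric_square[OF n]
  by (simp flip: mult_square_assoc[of _ n])

lemma minkowski_adjoint_carrier:
  assumes "X \<in> carrier_mat n n"
  shows "minkowski_adjoint n X \<in> carrier_mat n n"
  using assms minkowski_metric_carrier[OF n] unfolding minkowski_adjoint_def
  by (simp add: mult_square_carrier)

text \<open>Normal form for products: everything is associated to the right, and two adjacent copies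
  of the metric cancel even inside a longer product.\<close>

lemmas square_mat_simps = mult_square_assoc[of _ n] mult_square_carrier[of _ n]
  minkowski_metric_carrier[OF n] minkowski_metric_square[OF n] minkowski_metric_cancel
  minkowski_metric_adjoint[OF n] mat_adjoint_mult[of _ n n _ n] minkowski_adjoint_carrier

lemma minkowski_adjoint_mult:
  assumes "X \<in> carrier_mat n n" "Y \<in> carrier_mat n n"
  shows "minkowski_adjoint n (X * Y) = minkowski_adjoint n Y * minkowski_adjoint n X"
  using assms unfolding minkowski_adjoint_def by (simp add: square_mat_simps)

lemma minkowski_adjoint_adjoint:
  assumes "X \<in> carrier_mat n n"
  shows "minkowski_adjoint n (minkowski_adjoint n X) = X"
  using assms unfolding minkowski_adjoint_def by (simp add: square_mat_simps)

text \<open>The factor \<open>W\<close> records that the range of \<open>P\<close> lies in that of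
  \<open>M\<close>; with \<open>P * M = M\<close> the two ranges agree.\<close>

lemma minkowski_projection:
  assumes M: "M \<in> carrier_mat n n"
    and rank: "vec_space.rank n (minkowski_adjoint n M * M) = vec_space.rank n M"
  obtains P W where "P \<in> carrier_mat n n" "W \<in> carrier_mat n n" "minkowski_adjoint n P = P"
    "P * M = M" "P = M * W"
proof -
  let ?a = "minkowski_adjoint n"
  have aM: "?a M \<in> carrier_mat n n"
    using M by (rule minkowski_adjoint_carrier)
  obtain Z where Z: "Z \<in> carrier_mat n n" and M_eq: "M = Z * (?a M * M)"
    using rank_mult_eq_right[OF aM M rank] by blast
  define Q where "Q = Z * ?a M"
  have Q: "Q \<in> carrier_mat n n" and aZ: "?a Z \<in> carrier_mat n n"
    using Z aM by (auto simp: Q_def minkowski_adjoint_carrier)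
  have QM: "Q * M = M"
    unfolding Q_def mult_square_assoc[OF Z aM M] by (rule M_eq[symmetric])
  have aQ: "?a Q = M * ?a Z"
    using Z aM M by (simp add: Q_def minkowski_adjoint_mult minkowski_adjoint_adjoint)
  have aQ_car: "?a Q \<in> carrier_mat n n"
    using Q by (rule minkowski_adjoint_carrier)
  \<comment> \<open>\<open>Q\<close> fixes \<open>M\<close>, hence everything of the form
    \<open>M * X\<close>, and \<open>?a Q\<close> has this form.\<close>
  have QaQ: "?a Q = Q * ?a Q"
    using QM Q M aZ by (simp add: aQ flip: square_mat_simps(1))
  \<comment> \<open>The product \<open>Q * ?a Q\<close> is its own adjoint, so taking adjoints in
    \<open>QaQ\<close> replaces only the left side.\<close>
  have "?a (?a Q) = ?a (Q * ?a Q)"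
    by (rule arg_cong[OF QaQ])
  then have "Q = Q * ?a Q"
    using Q aQ_car by (simp add: minkowski_adjoint_mult minkowski_adjoint_adjoint)
  then have "?a Q = Q"
    by (rule trans[OF QaQ sym])
  with that[OF Q aZ] QM aQ show thesis
    by simp
qed

text \<open>\<open>P\<close> projects onto the range of \<open>A ^\<^sub>m k\<close>, which
  \<open>A\<close> maps onto itself by the rank condition \<open>ind\<close>. A right inverse
  \<open>V\<close> of \<open>A\<close> on that range turns both rank conditions into explicit
  factorizations.\<close>

lemma m_core_EP_exists:
  assumes A: "A \<in> carrier_mat n n" and k: "0 < k"
    and ind: "vec_space.rank n (A ^\<^sub>m Suc k) = vec_space.rank n (A ^\<^sub>m k)"
    and P: "P \<in> carrier_mat n n" and W: "W \<in> carrier_mat n n"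
    and aP: "minkowski_adjoint n P = P" and PM: "P * A ^\<^sub>m k = A ^\<^sub>m k" and PW: "P = A ^\<^sub>m k * W"
  shows "m_core_EP_decomposition n k A (P * A) (A - P * A)"
proof -
  let ?a = "minkowski_adjoint n"
  define M where "M = A ^\<^sub>m k"
  define D where "D = A - P * A"
  have M: "M \<in> carrier_mat n n" and PM: "P * M = M" and PW: "P = M * W"
    using A PM PW by (simp_all add: M_def)
  have comm: "A * M = M * A"
    using pow_mat_Suc_left[OF A, of k] by (simp add: M_def)
  have PA: "P * A \<in> carrier_mat n n"
    using P A by simp
  have D: "D \<in> carrier_mat n n"
    using PA unfolding D_def by (rule minus_carrier_mat)
  have aA: "?a A \<in> carrier_mat n n"
    using A by (rule minkowski_adjoint_carrier)
  have P_cancel: "P * (M * X) = M * X" if "X \<in> carrier_mat n n" for X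
    using that P M by (simp add: PM flip: mult_square_assoc[of _ n])
  have PP: "P * P = P"
    using P_cancel[OF W] PW by simp
  \<comment> \<open>Shows that the range of \<open>P\<close> is invariant under \<open>A\<close>:
    \<open>A\<close> commutes with its power \<open>M\<close>.\<close>
  have AP: "A * P = M * (A * W)"
  proof -
    have "A * P = A * M * W"
      unfolding PW by (rule mult_square_assoc[OF A M W, symmetric])
    also have "\<dots> = M * (A * W)"
      unfolding comm by (rule mult_square_assoc[OF M A W])
    finally show ?thesis .
  qed
  have PAP: "P * (A * P) = A * P"
    using P_cancel[of "A * W"] A W by (simp add: AP)
  have "\<exists>Z \<in> carrier_mat n n. M = M * A * Z"
    using ind by (intro vec_space.rank_mult_eq_left[OF M A]) (simp add: M_def)
  then obtain Z where Z: "Z \<in> carrier_mat n n" and MZ: "M = M * A * Z"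
    by blast
  \<comment> \<open>\<open>V\<close> is chosen so that
    \<open>A * V = A * M * Z * W = M * A * Z * W = M * W = P\<close>, with its own range inside that
    of \<open>P\<close>.\<close>
  define V where "V = M * (Z * W)"
  have V: "V \<in> carrier_mat n n"
    using M Z W by (simp add: V_def)
  have PV: "P * V = V"
    using P_cancel[of "Z * W"] Z W by (simp add: V_def)
  have AV: "A * V = P"
  proof -
    have "A * V = M * A * Z * W"
      using A M Z W unfolding V_def comm[symmetric] by (simp add: square_mat_simps)
    then show ?thesis
      by (simp only: MZ[symmetric] PW[symmetric])
  qed
  have PAV: "P * A * V = P"
  proof -
    have "P * A * V = P * (A * (P * V))"
      using P A V by (simp add: PV square_mat_simps)
    also have "\<dots> = P * (A * P) * V"
      using P A V by (simp add: square_mat_simps)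
    also have "\<dots> = A * (P * V)"
      unfolding PAP using P A V by (simp add: square_mat_simps)
    finally show ?thesis
      by (simp add: PV AV)
  qed
  have DP: "D * P = 0\<^sub>m n n"
  proof -
    have "D * P = A * P - P * A * P"
      unfolding D_def by (rule minus_mult_distrib_mat[OF A PA P])
    also have "P * A * P = A * P"
      using PAP P A by (simp add: square_mat_simps)
    finally show ?thesis
      using A P by (simp add: minus_r_inv_mat[of _ n n])
  qed
  \<comment> \<open>Since \<open>D * P = 0\<close>, left multiplication by \<open>D\<close> kills
    the correction term \<open>P * B\<close>. The formula starts at exponent 1: at exponent 0 its
    right side would be the identity minus \<open>P\<close>.\<close>
  have D_pow: "D ^\<^sub>m Suc j = A ^\<^sub>m Suc j - P * A ^\<^sub>m Suc j" for j
  proof (induction j)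
    case 0
    then show ?case
      using A D by (simp add: D_def)
  next
    case (Suc j)
    define B where "B = A ^\<^sub>m Suc j"
    have B: "B \<in> carrier_mat n n"
      using A unfolding B_def by (rule pow_carrier_mat)
    then have PB: "P * B \<in> carrier_mat n n"
      using P by simp
    have "D ^\<^sub>m Suc (Suc j) = D * (B - P * B)"
      using Suc pow_mat_Suc_left[OF D, of "Suc j"] by (simp add: B_def)
    also have "\<dots> = D * B - D * (P * B)"
      by (rule mult_minus_distrib_mat[OF D B PB])
    also have "D * (P * B) = 0\<^sub>m n n"
      using D P B DP by (simp flip: mult_square_assoc[of _ n])
    also have "D * B - 0\<^sub>m n n = D * B"
      using D B by (intro eq_matI) auto
    also have "D * B = A * B - P * A * B"
      unfolding D_def by (rule minus_mult_distrib_mat[OF A PA B])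
    also have "P * A * B = P * (A * B)"
      using P A B by (rule mult_square_assoc)
    also have "A * B = A ^\<^sub>m Suc (Suc j)"
      unfolding B_def by (rule pow_mat_Suc_left[OF A, symmetric])
    finally show ?case .
  qed
  have "D ^\<^sub>m k = 0\<^sub>m n n"
    \<comment> \<open>As \<open>k\<close> is positive, the formula applies at exponent
      \<open>k\<close>, where \<open>P * M = M\<close> cancels both terms.\<close>
    using D_pow[of "k - 1"] k PM M by (simp add: minus_r_inv_mat flip: M_def)
  moreover have "D * (P * A) = 0\<^sub>m n n"
    using D P A DP by (simp flip: mult_square_assoc[of _ n])
  moreover have "?a (P * A) * D = 0\<^sub>m n n"
  proof -
    have "P * D = P * A - P * (P * A)"
      unfolding D_def by (rule mult_minus_distrib_mat[OF P A PA])
    also have "P * (P * A) = P * A"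
      using P A by (simp add: PP flip: mult_square_assoc[of _ n])
    finally have "P * D = 0\<^sub>m n n"
      using PA by (simp add: minus_r_inv_mat)
    then show ?thesis
      using P A D aA by (simp add: minkowski_adjoint_mult aP mult_square_assoc[of _ n])
  qed
  moreover have "vec_space.rank n ((P * A) ^\<^sub>m 2) = vec_space.rank n (P * A)"
  proof (rule antisym)
    have sq: "(P * A) ^\<^sub>m 2 = P * A * (P * A)"
      using PA by (simp add: numeral_2_eq_2)
    show "vec_space.rank n ((P * A) ^\<^sub>m 2) \<le> vec_space.rank n (P * A)"
      unfolding sq by (rule vec_space.rank_mult_le_left[OF PA PA])
    \<comment> \<open>Each \<open>V\<close> undoes one factor \<open>P * A\<close> up to the
      projection, so the square times \<open>V * V\<close> is \<open>P\<close>; the last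
      \<open>A\<close> restores \<open>P * A\<close>.\<close>
    have "P * A * (P * A) * (V * V * A) = P * A * (P * A * V) * (V * A)"
      using P A V by (simp add: mult_square_assoc[of _ n])
    also have "\<dots> = P * A * (P * V) * A"
      unfolding PAV using P A V by (simp add: mult_square_assoc[of _ n])
    also have "\<dots> = P * A"
      unfolding PV PAV ..
    finally have "P * A = P * A * (P * A) * (V * V * A)" ..
    then show "vec_space.rank n (P * A) \<le> vec_space.rank n ((P * A) ^\<^sub>m 2)"
      unfolding sq using vec_space.rank_mult_le_left[of "P * A * (P * A)" n n "V * V * A" n] PA V A
      by simp
  qed
  moreover have "vec_space.rank n (P * A) = vec_space.rank n (?a (P * A) * (P * A))"
  proof (rule antisym)
    have aPA: "?a (P * A) \<in> carrier_mat n n" and aV: "?a V \<in> carrier_mat n n"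
      using PA V by (simp_all add: minkowski_adjoint_carrier)
    show "vec_space.rank n (?a (P * A) * (P * A)) \<le> vec_space.rank n (P * A)"
      by (rule rank_mult_le_right[OF aPA PA])
    \<comment> \<open>The adjoint of \<open>PAV\<close>: it lets \<open>?a V\<close> recover
      \<open>P * A\<close> from \<open>?a (P * A) * (P * A)\<close> by a left
      multiplication.\<close>
    have "?a V * ?a (P * A) = P"
      using minkowski_adjoint_mult[OF PA V] PAV aP by simp
    then have "?a V * (?a (P * A) * (P * A)) = P * (P * A)"
      using PA aPA aV by (simp flip: mult_square_assoc[of _ n])
    also have "\<dots> = P * A"
      using P A by (simp add: PP flip: mult_square_assoc[of _ n])
    finally have "?a V * (?a (P * A) * (P * A)) = P * A" .
    then show "vec_space.rank n (P * A) \<le> vec_space.rank n (?a (P * A) * (P * A))"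
      using rank_mult_le_right[OF aV, of "?a (P * A) * (P * A)" n] PA aPA by simp
  qed
  moreover have "A = P * A + D"
    unfolding D_def using PA A by (rule mat_add_diff[symmetric])
  ultimately show ?thesis
    unfolding m_core_EP_decomposition_def D_def[symmetric] using PA D by (intro conjI)
qed

lemma m_core_EP_unique:
  assumes dec: "m_core_EP_decomposition n k A A1 A2"
    and P: "P \<in> carrier_mat n n" and W: "W \<in> carrier_mat n n"
    and aP: "minkowski_adjoint n P = P" and PM: "P * A ^\<^sub>m k = A ^\<^sub>m k" and PW: "P = A ^\<^sub>m k * W"
  shows "A1 = P * A" and "A2 = A - P * A"
proof -
  let ?a = "minkowski_adjoint n"
  have A1: "A1 \<in> carrier_mat n n" and A2: "A2 \<in> carrier_mat n n" and A_eq: "A = A1 + A2"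
    and rank: "vec_space.rank n (A1 ^\<^sub>m 2) = vec_space.rank n A1"
    and A2k: "A2 ^\<^sub>m k = 0\<^sub>m n n" and aA12: "?a A1 * A2 = 0\<^sub>m n n" and A21: "A2 * A1 = 0\<^sub>m n n"
    using dec unfolding m_core_EP_decomposition_def by simp_all
  define M where "M = A ^\<^sub>m k"
  have A: "A \<in> carrier_mat n n"
    using A1 A2 A_eq by simp
  have M: "M \<in> carrier_mat n n" and PM: "P * M = M" and PW: "P = M * W"
    using A PM PW by (simp_all add: M_def)
  \<comment> \<open>Because \<open>A2 * A1 = 0\<close>, \<open>A\<close> acts on the range of
    \<open>A1\<close> as \<open>A1\<close> does.\<close>
  have AA1: "A * A1 = A1 * A1"
    unfolding A_eq using A1 A2 by (simp add: add_mult_distrib_mat[of _ n n] A21)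
  have "A1 ^\<^sub>m 2 = A1 * A1"
    using A1 by (simp add: numeral_2_eq_2)
  then have "\<exists>Z \<in> carrier_mat n n. A1 = A1 * A1 * Z"
    using rank by (intro vec_space.rank_mult_eq_left[OF A1 A1]) simp
  then obtain Z where Z: "Z \<in> carrier_mat n n" and A1Z: "A1 = A1 * A1 * Z"
    by blast
  \<comment> \<open>The range of \<open>A1\<close> lies in that of every power of \<open>A\<close>:
    \<open>A1 = A1 * A1 * Z = A * A1 * Z\<close> pulls out one more factor \<open>A\<close> at each
    step. The case \<open>j = k\<close> makes \<open>P\<close> fix \<open>A1\<close>.\<close>
  have "\<exists>X \<in> carrier_mat n n. A1 = A ^\<^sub>m j * (A1 * X)" for j
  proof (induction j)
    case 0
    then show ?case
      using A A1 by (intro bexI[of _ "1\<^sub>m n"]) auto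
  next
    case (Suc j)
    then obtain X where X: "X \<in> carrier_mat n n" and eq: "A1 = A ^\<^sub>m j * (A1 * X)"
      by blast
    have Aj: "A ^\<^sub>m j \<in> carrier_mat n n"
      using A by simp
    have "A1 * X = A1 * A1 * Z * X"
      by (simp only: A1Z[symmetric])
    also have "\<dots> = A * (A1 * (Z * X))"
      using A A1 Z X by (simp add: mult_square_assoc[of _ n] flip: AA1)
    finally have "A1 = A ^\<^sub>m j * (A * (A1 * (Z * X)))"
      by (rule subst[of _ _ "\<lambda>B. A1 = A ^\<^sub>m j * B", OF _ eq])
    also have "\<dots> = A ^\<^sub>m Suc j * (A1 * (Z * X))"
      using Aj A A1 Z X by (simp add: mult_square_assoc[of _ n])
    finally show ?case
      using Z X by (intro bexI[of _ "Z * X"]) auto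
  qed
  then obtain X where X: "X \<in> carrier_mat n n" and A1X: "A1 = M * (A1 * X)"
    unfolding M_def by blast
  have A1X_carrier: "A1 * X \<in> carrier_mat n n"
    using A1 X by simp
  have "P * (M * (A1 * X)) = M * (A1 * X)"
    unfolding mult_square_assoc[OF P M A1X_carrier, symmetric] PM ..
  then have PA1: "P * A1 = A1"
    unfolding A1X[symmetric] .
  \<comment> \<open>Expanding a power of \<open>A1 + A2\<close> with \<open>A2 * A1 = 0\<close>
    leaves terms that start with \<open>A1\<close>, and the pure power of \<open>A2\<close>. That
    power vanishes at \<open>j = k\<close>, so the range of \<open>M\<close> lies in that of
    \<open>A1\<close>.\<close>
  have "\<exists>Y \<in> carrier_mat n n. A ^\<^sub>m j = A1 * Y + A2 ^\<^sub>m j" for j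
  proof (induction j)
    case 0
    then show ?case
      using A A1 A2 by (intro bexI[of _ "0\<^sub>m n n"]) auto
  next
    case (Suc j)
    then obtain Y where Y: "Y \<in> carrier_mat n n" and eq: "A ^\<^sub>m j = A1 * Y + A2 ^\<^sub>m j"
      by blast
    have Aj: "A ^\<^sub>m j \<in> carrier_mat n n" and A2j: "A2 ^\<^sub>m j \<in> carrier_mat n n"
      using A A2 by simp_all
    have "A ^\<^sub>m Suc j = A1 * A ^\<^sub>m j + A2 * A ^\<^sub>m j"
      unfolding pow_mat_Suc_left[OF A] by (subst A_eq, rule add_mult_distrib_mat[OF A1 A2 Aj])
    also have "A2 * A ^\<^sub>m j = A2 * (A1 * Y) + A2 * A2 ^\<^sub>m j"
      unfolding eq using A1 A2 Y A2j by (intro mult_add_distrib_mat) auto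
    also have "A2 * (A1 * Y) = 0\<^sub>m n n"
      using A1 A2 Y A21 by (simp flip: mult_square_assoc[of _ n])
    also have "0\<^sub>m n n + A2 * A2 ^\<^sub>m j = A2 ^\<^sub>m Suc j"
      unfolding pow_mat_Suc_left[OF A2] using A2 A2j by simp
    finally show ?case
      using Aj by blast
  qed
  then obtain Y where Y: "Y \<in> carrier_mat n n" and "M = A1 * Y + A2 ^\<^sub>m k"
    unfolding M_def by blast
  then have MY: "M = A1 * Y"
    using A1 Y A2k by simp
  have "P = A1 * Y * W"
    using PW MY by simp
  then have "P = A1 * (Y * W)"
    using A1 Y W by (simp add: mult_square_assoc[of _ n])
  \<comment> \<open>Self-adjointness moves \<open>A1\<close> to the right end as
    \<open>?a A1\<close>, which annihilates \<open>A2\<close>.\<close>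
  then have "P = ?a (Y * W) * ?a A1"
    using aP minkowski_adjoint_mult[OF A1, of "Y * W"] Y W by simp
  then have "P * A2 = ?a (Y * W) * (?a A1 * A2)"
    using A1 A2 Y W by (simp add: mult_square_assoc[of _ n] minkowski_adjoint_carrier)
  then have PA2: "P * A2 = 0\<^sub>m n n"
    using Y W by (simp add: aA12 minkowski_adjoint_carrier right_mult_zero_mat[of _ n n])
  have "P * A = P * A1 + P * A2"
    unfolding A_eq using P A1 A2 by (rule mult_add_distrib_mat)
  then show "A1 = P * A"
    using A1 by (simp add: PA1 PA2)
  then show "A2 = A - P * A"
    using mat_add_diff_left[OF A1 A2] A_eq by simp
qed

end

section \<open>Block matrices\<close>

lemma four_block_mat_eqD:
  assumes eq: "four_block_mat A B C D = four_block_mat A' B' C' D'"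
    and "A \<in> carrier_mat p q" "B \<in> carrier_mat p q'" "C \<in> carrier_mat p' q" "D \<in> carrier_mat p' q'"
    and "A' \<in> carrier_mat p q" "B' \<in> carrier_mat p q'" "C' \<in> carrier_mat p' q"
      "D' \<in> carrier_mat p' q'"
  shows "A = A'" "B = B'" "C = C'" "D = D'"
proof -
  have idx: "four_block_mat A B C D $$ (i, j) = four_block_mat A' B' C' D' $$ (i, j)" for i j
    using eq by simp
  show "A = A'"
  proof (rule eq_matI)
    fix i j assume "i < dim_row A'" "j < dim_col A'"
    then show "A $$ (i, j) = A' $$ (i, j)"
      using idx[of i j] assms(2-) by simp
  qed (use assms(2-) in auto)
  show "B = B'"
  proof (rule eq_matI)
    fix i j assume "i < dim_row B'" "j < dim_col B'"
    then show "B $$ (i, j) = B' $$ (i, j)"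
      using idx[of i "q + j"] assms(2-) by simp
  qed (use assms(2-) in auto)
  show "C = C'"
  proof (rule eq_matI)
    fix i j assume "i < dim_row C'" "j < dim_col C'"
    then show "C $$ (i, j) = C' $$ (i, j)"
      using idx[of "p + i" j] assms(2-) by simp
  qed (use assms(2-) in auto)
  show "D = D'"
  proof (rule eq_matI)
    fix i j assume "i < dim_row D'" "j < dim_col D'"
    then show "D $$ (i, j) = D' $$ (i, j)"
      using idx[of "p + i" "q + j"] assms(2-) by simp
  qed (use assms(2-) in auto)
qed

lemma carrier_mat_blocks:
  assumes "A \<in> carrier_mat (p + p') (q + q')"
  obtains A1 A2 A3 A4 where "A1 \<in> carrier_mat p q" "A2 \<in> carrier_mat p q'"
    "A3 \<in> carrier_mat p' q" "A4 \<in> carrier_mat p' q'" "A = four_block_mat A1 A2 A3 A4"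
proof -
  obtain A1 A2 A3 A4 where "split_block A p q = (A1, A2, A3, A4)"
    by (metis prod_cases4)
  from that[OF split_block[OF this, of p' q']] assms show thesis
    by simp
qed

lemma mat_adjoint_four_block_mat:
  assumes "A \<in> carrier_mat p q" "B \<in> carrier_mat p q'" "C \<in> carrier_mat p' q" "D \<in> carrier_mat p' q'"
  shows "mat_adjoint (four_block_mat A B C D) =
    four_block_mat (mat_adjoint A) (mat_adjoint C) (mat_adjoint B) (mat_adjoint D)"
  by (rule eq_matI) (use assms in \<open>auto simp: index_mat_adjoint\<close>)

lemma mat_adjoint_one [simp]:
  "mat_adjoint (1\<^sub>m n) = (1\<^sub>m n :: complex mat)"
  by (rule eq_matI) (auto simp: index_mat_adjoint)

lemma mat_adjoint_zero [simp]:
  "mat_adjoint (0\<^sub>m p q) = (0\<^sub>m q p :: 'a :: conjugatable_field mat)"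
  by (rule eq_matI) (auto simp: index_mat_adjoint)

text \<open>Only the diagonal blocks of the power matter later, so the corner \<open>R\<close> stays
  unspecified.\<close>

lemma block_upper_triangular_pow:
  fixes T S N :: "'a :: semiring_1 mat"
  assumes T: "T \<in> carrier_mat r r" and S: "S \<in> carrier_mat r m" and N: "N \<in> carrier_mat m m"
  shows "\<exists>R \<in> carrier_mat r m. four_block_mat T S (0\<^sub>m m r) N ^\<^sub>m k =
    four_block_mat (T ^\<^sub>m k) R (0\<^sub>m m r) (N ^\<^sub>m k)"
proof (induction k)
  case 0
  then show ?case
    using T N by (intro bexI[of _ "0\<^sub>m r m"]) auto
next
  case (Suc k)
  then obtain R where R: "R \<in> carrier_mat r m" and eq: "four_block_mat T S (0\<^sub>m m r) N ^\<^sub>m k =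
    four_block_mat (T ^\<^sub>m k) R (0\<^sub>m m r) (N ^\<^sub>m k)"
    by blast
  have Tk: "T ^\<^sub>m k \<in> carrier_mat r r" and Nk: "N ^\<^sub>m k \<in> carrier_mat m m"
    using T N by simp_all
  have "four_block_mat T S (0\<^sub>m m r) N ^\<^sub>m Suc k =
    four_block_mat (T ^\<^sub>m k) R (0\<^sub>m m r) (N ^\<^sub>m k) * four_block_mat T S (0\<^sub>m m r) N"
    by (simp add: eq)
  also have "\<dots> = four_block_mat (T ^\<^sub>m Suc k) (T ^\<^sub>m k * S + R * N) (0\<^sub>m m r) (N ^\<^sub>m Suc k)"
    using T S N R Tk Nk
    by (subst mult_four_block_mat[OF Tk R zero_carrier_mat Nk T S zero_carrier_mat N])
      (auto simp: right_mult_zero_mat[of _ _ m] left_mult_zero_mat[of _ r])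
  finally show ?case
    using Tk S R N by (intro bexI[of _ "T ^\<^sub>m k * S + R * N"]) auto
qed

lemma pow_mat_inverse:
  fixes T V :: "'a :: semiring_1 mat"
  assumes T: "T \<in> carrier_mat r r" and V: "V \<in> carrier_mat r r" and TV: "T * V = 1\<^sub>m r"
  shows "T ^\<^sub>m k * V ^\<^sub>m k = 1\<^sub>m r"
proof (induction k)
  case (Suc k)
  have Tk: "T ^\<^sub>m k \<in> carrier_mat r r" and Vk: "V ^\<^sub>m k \<in> carrier_mat r r"
    using T V by simp_all
  have "T ^\<^sub>m Suc k * V ^\<^sub>m Suc k = T ^\<^sub>m k * (T * (V * V ^\<^sub>m k))"
    unfolding pow_mat_Suc_left[OF V] pow_mat.simps(2)[of T]
    by (rule mult_square_assoc[OF Tk T mult_square_carrier[OF V Vk]])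
  also have "T * (V * V ^\<^sub>m k) = V ^\<^sub>m k"
    unfolding mult_square_assoc[OF T V Vk, symmetric] TV by (rule left_mult_one_mat[OF Vk])
  finally show ?case
    using Suc by simp
qed (use T V in simp)

text \<open>A one-sided inverse of a square matrix over a field is two-sided and makes
  \<open>A\<close> a unit, so \<open>mat_inverse\<close> succeeds; its result \<open>C\<close>
  equals \<open>B * A * C = B\<close>.\<close>

lemma mat_inverse_SomeI:
  fixes A B :: "'a :: field mat"
  assumes A: "A \<in> carrier_mat r r" and B: "B \<in> carrier_mat r r" and AB: "A * B = 1\<^sub>m r"
  shows "mat_inverse A = Some B"
proof -
  have BA: "B * A = 1\<^sub>m r"
    by (rule mat_mult_left_right_inverse[OF A B AB])
  have "A \<in> Units (ring_mat TYPE('a) r ())"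
    using A B AB BA unfolding Units_def by (auto simp: ring_mat_simps)
  then obtain C where C: "mat_inverse A = Some C"
    using mat_inverse(1)[OF A, of "()"] by (cases "mat_inverse A") auto
  then have "A * C = 1\<^sub>m r" "C \<in> carrier_mat r r"
    using mat_inverse(2)[OF A C] by auto
  then have "C = B * A * C"
    using BA by simp
  also have "\<dots> = B"
    using A B \<open>C \<in> _\<close> \<open>A * C = _\<close> by (simp add: mult_square_assoc[of _ r])
  finally show ?thesis
    using C by simp
qed

text \<open>No nondegeneracy of \<open>G1\<close> has to be assumed: the form is an involution and
  \<open>G2 = G1 p2\<close>, so the upper left block of \<open>K K = 1\<close> exhibits an inverse of \<open>G1\<close>.\<close>

lemma block_projection:
  fixes P W :: "complex mat"
  assumes r: "r + m = n"
    and K: "G1 \<in> carrier_mat r r" "G2 \<in> carrier_mat r m" "G3 \<in> carrier_mat m r" "G4 \<in> carrier_mat m m"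
    and KK: "four_block_mat G1 G2 G3 G4 * four_block_mat G1 G2 G3 G4 = 1\<^sub>m n"
    and T: "T \<in> carrier_mat r r" and V: "V \<in> carrier_mat r r" and TV: "T * V = 1\<^sub>m r"
    and R: "R \<in> carrier_mat r m"
    and P: "P \<in> carrier_mat n n" and W: "W \<in> carrier_mat n n"
    and PF: "P * four_block_mat T R (0\<^sub>m m r) (0\<^sub>m m m) = four_block_mat T R (0\<^sub>m m r) (0\<^sub>m m m)"
    and PW: "P = four_block_mat T R (0\<^sub>m m r) (0\<^sub>m m m) * W"
    and KP: "four_block_mat G1 G2 G3 G4 * P = mat_adjoint P * four_block_mat G1 G2 G3 G4"
  obtains G1inv where "G1inv \<in> carrier_mat r r" "mat_inverse G1 = Some G1inv"
    "P = four_block_mat (1\<^sub>m r) (G1inv * G2) (0\<^sub>m m r) (0\<^sub>m m m)"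
proof -
  have "W \<in> carrier_mat (r + m) (r + m)"
    using W r by simp
  then obtain W1 W2 W3 W4 where Wb: "W1 \<in> carrier_mat r r" "W2 \<in> carrier_mat r m"
    "W3 \<in> carrier_mat m r" "W4 \<in> carrier_mat m m" "W = four_block_mat W1 W2 W3 W4"
    by (rule carrier_mat_blocks)
  \<comment> \<open>The upper blocks of the product in \<open>PW\<close>. The zero lower rows of its
    left factor make the lower blocks of \<open>P\<close> vanish.\<close>
  define p1 p2 where p_def: "p1 = T * W1 + R * W3" "p2 = T * W2 + R * W4"
  have p: "p1 \<in> carrier_mat r r" "p2 \<in> carrier_mat r m"
    using T R Wb by (simp_all add: p_def)
  have Pb: "P = four_block_mat p1 p2 (0\<^sub>m m r) (0\<^sub>m m m)"
    unfolding PW Wb(5) p_def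
    by (subst mult_four_block_mat[OF T R zero_carrier_mat zero_carrier_mat Wb(1-4)])
      (use Wb in \<open>simp add: left_mult_zero_mat[of _ r] left_mult_zero_mat[of _ m]\<close>)
  have "four_block_mat (p1 * T) (p1 * R) (0\<^sub>m m r) (0\<^sub>m m m) = four_block_mat T R (0\<^sub>m m r) (0\<^sub>m m m)"
    using PF unfolding Pb
    by (subst (asm) mult_four_block_mat[OF p zero_carrier_mat zero_carrier_mat T R zero_carrier_mat zero_carrier_mat])
      (use p T R in \<open>simp add: left_mult_zero_mat[of _ r] right_mult_zero_mat[of _ _ m]\<close>)
  \<comment> \<open>\<open>P\<close> fixes the first block column, and the invertible corner
    \<open>T\<close> can be cancelled, which leaves \<open>p1 = 1\<close>.\<close>
  from four_block_mat_eqD(1)[OF this, of r r m m] have p1T: "p1 * T = T"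
    using p T R by simp
  have "p1 = p1 * (T * V)"
    using p TV by simp
  also have "\<dots> = p1 * T * V"
    by (rule mult_square_assoc[OF p(1) T V, symmetric])
  finally have p1: "p1 = 1\<^sub>m r"
    by (simp add: p1T TV)
  have aP: "mat_adjoint P = four_block_mat (1\<^sub>m r) (0\<^sub>m r m) (mat_adjoint p2) (0\<^sub>m m m)"
    unfolding Pb p1 using p by (subst mat_adjoint_four_block_mat[of _ r r _ m _ m]) auto
  have ap2: "mat_adjoint p2 \<in> carrier_mat m r"
    using p by simp
  \<comment> \<open>Both sides of the self-adjointness condition \<open>KP\<close>, multiplied out;
    the upper right blocks determine \<open>p2\<close>.\<close>
  have "four_block_mat G1 (G1 * p2) G3 (G3 * p2) = four_block_mat G1 G2 (mat_adjoint p2 * G1) (mat_adjoint p2 * G2)"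
    using KP unfolding aP unfolding Pb p1
    by (subst (asm) mult_four_block_mat[OF K one_carrier_mat p(2) zero_carrier_mat zero_carrier_mat],
        subst (asm) mult_four_block_mat[OF one_carrier_mat zero_carrier_mat ap2 zero_carrier_mat K])
      (use K p ap2 in \<open>simp add: left_mult_zero_mat[of _ m] right_mult_zero_mat[of _ _ m]\<close>)
  note e = four_block_mat_eqD[OF this, of r r m m]
  have G2: "G1 * p2 = G2"
    by (rule e(2)) (use K p ap2 in auto)
  have "four_block_mat (G1 * G1 + G2 * G3) (G1 * G2 + G2 * G4) (G3 * G1 + G4 * G3) (G3 * G2 + G4 * G4)
      = four_block_mat (1\<^sub>m r) (0\<^sub>m r m) (0\<^sub>m m r) (1\<^sub>m m)"
    using KK r mult_four_block_mat[OF K K] by simp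
  from four_block_mat_eqD(1)[OF this, of r r m m] have "G1 * G1 + G2 * G3 = 1\<^sub>m r"
    using K by simp
  moreover have "G2 * G3 = G1 * (p2 * G3)"
    unfolding G2[symmetric] using K p by (intro assoc_mult_mat) auto
  ultimately have "G1 * (G1 + p2 * G3) = 1\<^sub>m r"
    using K p by (subst mult_add_distrib_mat[of _ r r]) auto
  moreover have car: "G1 + p2 * G3 \<in> carrier_mat r r"
    using K p by auto
  ultimately have inv: "mat_inverse G1 = Some (G1 + p2 * G3)"
    using K by (intro mat_inverse_SomeI)
  then have "(G1 + p2 * G3) * G1 = 1\<^sub>m r"
    using mat_inverse(2)[OF K(1)] by blast
  then have "(G1 + p2 * G3) * G2 = p2"
    unfolding G2[symmetric] assoc_mult_mat[OF car K(1) p(2), symmetric] using p by simp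
  then show thesis
    using that[OF car inv] Pb p1 by simp
qed

text \<open>Conjugation by the unitary \<open>U\<close> carries \<open>A\<close>, \<open>P\<close>
  and the metric to block coordinates. There \<open>block_projection\<close> gives \<open>P\<close>,
  and the two summands follow by block multiplication.\<close>

lemma m_core_EP_block_form:
  assumes n: "n \<ge> 1" and r: "r \<le> n"
    and P: "P \<in> carrier_mat n n" and W: "W \<in> carrier_mat n n"
    and aP: "minkowski_adjoint n P = P" and PM: "P * A ^\<^sub>m k = A ^\<^sub>m k" and PW: "P = A ^\<^sub>m k * W"
    and core: "core_EP_decomposition n k r A U T S N"
    and K: "G1 \<in> carrier_mat r r" "G2 \<in> carrier_mat r (n - r)"
      "G3 \<in> carrier_mat (n - r) r" "G4 \<in> carrier_mat (n - r) (n - r)"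
    and K_eq: "mat_adjoint U * minkowski_metric n * U = four_block_mat G1 G2 G3 G4"
  shows "\<exists>G1inv. mat_inverse G1 = Some G1inv \<and>
    P * A = U * four_block_mat T (S + G1inv * G2 * N)
      (0\<^sub>m (n - r) r) (0\<^sub>m (n - r) (n - r)) * mat_adjoint U \<and>
    A - P * A = U * four_block_mat (0\<^sub>m r r) (- (G1inv * G2 * N))
      (0\<^sub>m (n - r) r) N * mat_adjoint U"
proof -
  define m where "m = n - r"
  have rm: "r + m = n"
    using r by (simp add: m_def)
  define B where "B = four_block_mat T S (0\<^sub>m m r) N"
  define V where "V = mat_adjoint U"
  define G where "G = minkowski_metric n"
  have U: "U \<in> carrier_mat n n" and VU: "V * U = 1\<^sub>m n" and UV: "U * V = 1\<^sub>m n"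
    and T: "T \<in> carrier_mat r r" and invT: "invertible_mat T" and S: "S \<in> carrier_mat r m"
    and N: "N \<in> carrier_mat m m" and Nk: "N ^\<^sub>m k = 0\<^sub>m m m" and A_eq: "A = U * B * V"
    using core unfolding core_EP_decomposition_def unitary_mat_def B_def V_def m_def by simp_all
  note K = K[folded m_def]
  have V: "V \<in> carrier_mat n n"
    using U by (simp add: V_def)
  have G: "G \<in> carrier_mat n n" and GG: "G * G = 1\<^sub>m n"
    using n by (simp_all add: G_def minkowski_metric_carrier minkowski_metric_square)
  have B: "B \<in> carrier_mat n n"
    unfolding B_def using four_block_carrier_mat[OF T N] by (simp add: rm)
  have cancel: "U * (V * X) = X" "V * (U * X) = X" "G * (G * X) = X" if "X \<in> carrier_mat n n" for X
    using that mult_square_assoc[OF U V that] mult_square_assoc[OF V U that]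
      mult_square_assoc[OF G G that] by (simp_all add: UV VU GG)
  note simps = mult_square_assoc[of _ n] mult_square_carrier[of _ n] cancel
    right_mult_one_mat[of _ n n]
  \<comment> \<open>The inverse supplied by \<open>invertible_mat\<close> comes without a size; the
    sizes of the two identity products determine it.\<close>
  obtain T' where T': "T' \<in> carrier_mat r r" "T * T' = 1\<^sub>m r"
  proof -
    obtain T' where inv: "T * T' = 1\<^sub>m (dim_row T)" "T' * T = 1\<^sub>m (dim_row T')"
      using invT unfolding invertible_mat_def inverts_mat_def by blast
    have "dim_col T' = r" "dim_row T' = r"
      using arg_cong[OF inv(1), of dim_col] arg_cong[OF inv(2), of dim_col] T by auto
    with that[of T'] inv T show thesis
      by auto
  qed
  have Tk: "T ^\<^sub>m k \<in> carrier_mat r r" and T'k: "T' ^\<^sub>m k \<in> carrier_mat r r"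
    using T T' by simp_all
  have TT'k: "T ^\<^sub>m k * T' ^\<^sub>m k = 1\<^sub>m r"
    by (rule pow_mat_inverse[OF T T'])
  \<comment> \<open>Nilpotency of \<open>N\<close> clears the lower right block, so the range of the
    power is spanned by the first \<open>r\<close> coordinates.\<close>
  obtain R where R: "R \<in> carrier_mat r m"
    and Bk: "B ^\<^sub>m k = four_block_mat (T ^\<^sub>m k) R (0\<^sub>m m r) (0\<^sub>m m m)"
    using block_upper_triangular_pow[OF T S N, of k] unfolding B_def Nk by blast
  have F: "B ^\<^sub>m k \<in> carrier_mat n n"
    using B by simp
  have Ak: "A ^\<^sub>m k = U * B ^\<^sub>m k * V"
  proof -
    have "similar_mat_wit A B U V"
      using A_eq U V B UV VU by (intro similar_mat_witI[of _ _ n]) auto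
    from similar_mat_wit_pow[OF this, of k] show ?thesis
      unfolding similar_mat_wit_def by (auto simp: Let_def)
  qed
  let ?P = "V * (P * U)" and ?W = "V * (W * U)"
  have P0: "?P \<in> carrier_mat n n" and W0: "?W \<in> carrier_mat n n"
    using U V P W by (simp_all add: simps)
  have "?P * B ^\<^sub>m k = V * (P * A ^\<^sub>m k) * U"
    using U V P F by (simp add: Ak VU simps)
  also have "\<dots> = B ^\<^sub>m k"
    unfolding PM unfolding Ak using U V F by (simp add: VU simps)
  finally have PF: "?P * B ^\<^sub>m k = B ^\<^sub>m k" .
  have PF': "?P = B ^\<^sub>m k * ?W"
    unfolding PW unfolding Ak using U V F W by (simp add: simps)
  have K_eq': "four_block_mat G1 G2 G3 G4 = V * (G * U)"
    using K_eq U V G by (simp add: V_def G_def mult_square_assoc[of _ n])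
  have KK: "four_block_mat G1 G2 G3 G4 * four_block_mat G1 G2 G3 G4 = 1\<^sub>m n"
    unfolding K_eq' using U V G by (simp add: simps VU)
  have aPc: "mat_adjoint P \<in> carrier_mat n n"
    using P by simp
  \<comment> \<open>Self-adjointness of \<open>P\<close> for the metric, with one factor
    \<open>G\<close> moved across by \<open>G * G = 1\<close>.\<close>
  have GP: "G * P = mat_adjoint P * G"
  proof -
    have "G * P = G * (G * (mat_adjoint P * G))"
      using aP P G by (simp add: minkowski_adjoint_def G_def mult_square_assoc[of _ n])
    then show ?thesis
      using aPc G by (simp add: simps)
  qed
  \<comment> \<open>The change of basis commutes with the adjoint because \<open>U\<close> is
    unitary.\<close>
  have "mat_adjoint ?P = V * (mat_adjoint P * U)"
    using U V P by (simp add: mat_adjoint_mult[of _ n n _ n] V_def mult_square_assoc[of _ n])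
  then have "mat_adjoint ?P * (V * (G * U)) = V * (mat_adjoint P * G * U)"
    using U V G aPc by (simp add: simps)
  also have "\<dots> = V * (G * U) * ?P"
    unfolding GP[symmetric] using U V G P by (simp add: simps)
  finally have KP: "four_block_mat G1 G2 G3 G4 * ?P = mat_adjoint ?P * four_block_mat G1 G2 G3 G4"
    unfolding K_eq' ..
  obtain H where H: "H \<in> carrier_mat r r" "mat_inverse G1 = Some H"
    and P_blocks: "?P = four_block_mat (1\<^sub>m r) (H * G2) (0\<^sub>m m r) (0\<^sub>m m m)"
    using block_projection[OF rm K KK Tk T'k TT'k R P0 W0 PF[unfolded Bk] PF'[unfolded Bk] KP] .
  let ?C1 = "four_block_mat T (S + H * G2 * N) (0\<^sub>m m r) (0\<^sub>m m m)"
    and ?C2 = "four_block_mat (0\<^sub>m r r) (- (H * G2 * N)) (0\<^sub>m m r) N"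
  have HG2: "H * G2 \<in> carrier_mat r m" and HG2N: "H * G2 * N \<in> carrier_mat r m"
    using H K N by simp_all
  have C1: "?C1 \<in> carrier_mat n n" and C2: "?C2 \<in> carrier_mat n n"
    using four_block_carrier_mat[OF T zero_carrier_mat[of m m]]
      four_block_carrier_mat[OF zero_carrier_mat[of r r] N] by (simp_all add: rm)
  have PB: "?P * B = ?C1"
    unfolding P_blocks B_def
    by (subst mult_four_block_mat[OF one_carrier_mat HG2 zero_carrier_mat zero_carrier_mat T S zero_carrier_mat N])
      (use T S N HG2 HG2N in \<open>simp add: left_mult_zero_mat[of _ r] left_mult_zero_mat[of _ m]
        right_mult_zero_mat[of _ _ m]\<close>)
  have "P * A = U * (?P * B) * V"
    using U V P B by (simp add: A_eq simps)
  then have PA: "P * A = U * ?C1 * V"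
    by (simp only: PB)
  \<comment> \<open>The second summand needs no separate product: it is what remains of
    \<open>B\<close> after removing \<open>?C1\<close>.\<close>
  have "?C1 + ?C2 = B"
    unfolding B_def
    by (subst add_four_block_mat[of _ r r _ m _ m])
      (use T S N HG2N in \<open>simp_all add: mat_add_uminus_cancel del: assoc_add_mat\<close>)
  then have "A = U * (?C1 + ?C2) * V"
    using A_eq by simp
  also have "\<dots> = U * ?C1 * V + U * ?C2 * V"
    using U V C1 C2
    by (simp only: mult_add_distrib_mat[OF U C1 C2]
        add_mult_distrib_mat[OF mult_square_carrier[OF U C1] mult_square_carrier[OF U C2] V])
  finally have "A - P * A = U * ?C2 * V"
    unfolding PA using U V C1 C2 by (simp add: mat_add_diff_left[of _ n n] mult_square_carrier[of _ n])
  with PA H show ?thesis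
    unfolding m_def V_def by blast
qed

text \<open>The block form can be claimed for all decompositions at once because each equals the
  pair \<open>P * A\<close>, \<open>A - P * A\<close>. The equation for
  \<open>mat_inverse G1\<close> also carries the invertibility of \<open>G1\<close>.\<close>

theorem theorem3p1:
  fixes n k r :: nat and A :: "complex mat"
  assumes "n \<ge> 1"
    and "A \<in> carrier_mat n n"
    and "mat_index n A = k"
    and "vec_space.rank n (A ^\<^sub>m k) = r"
    and "vec_space.rank n (minkowski_adjoint n (A ^\<^sub>m k) * A ^\<^sub>m k) = r"
  shows "(\<exists>A1 A2. m_core_EP_decomposition n k A A1 A2) \<and>
    (\<forall>A1 A2. m_core_EP_decomposition n k A A1 A2 \<longrightarrow>
      (\<forall>U T S N G1 G2 G3 G4.
         core_EP_decomposition n k r A U T S N \<and>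
         G1 \<in> carrier_mat r r \<and> G2 \<in> carrier_mat r (n - r) \<and>
         G3 \<in> carrier_mat (n - r) r \<and> G4 \<in> carrier_mat (n - r) (n - r) \<and>
         mat_adjoint U * minkowski_metric n * U = four_block_mat G1 G2 G3 G4 \<longrightarrow>
         (\<exists>G1inv. mat_inverse G1 = Some G1inv \<and>
            A1 = U * four_block_mat T (S + G1inv * G2 * N)
                       (0\<^sub>m (n - r) r) (0\<^sub>m (n - r) (n - r)) * mat_adjoint U \<and>
            A2 = U * four_block_mat (0\<^sub>m r r) (- (G1inv * G2 * N))
                       (0\<^sub>m (n - r) r) N * mat_adjoint U)))"
proof -
  note n = \<open>n \<ge> 1\<close> and A = \<open>A \<in> carrier_mat n n\<close>
  have k: "0 < k" and ind: "vec_space.rank n (A ^\<^sub>m Suc k) = vec_space.rank n (A ^\<^sub>m k)"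
    using mat_index_properties[OF A] unfolding \<open>mat_index n A = k\<close> by simp_all
  have M: "A ^\<^sub>m k \<in> carrier_mat n n"
    using A by simp
  have r: "r \<le> n"
    using vec_space.rank_le_nc[OF M] assms(4) by simp
  \<comment> \<open>\<open>P\<close> is built from \<open>A\<close> alone, before any decomposition
    or \<open>U\<close> is fixed, so the same \<open>P\<close> serves existence, uniqueness and the
    block form.\<close>
  obtain P W where P: "P \<in> carrier_mat n n" "W \<in> carrier_mat n n" "minkowski_adjoint n P = P"
    "P * A ^\<^sub>m k = A ^\<^sub>m k" "P = A ^\<^sub>m k * W"
    using minkowski_projection[OF n M] assms(4,5) by metis
  have unique: "A1 = P * A \<and> A2 = A - P * A" if "m_core_EP_decomposition n k A A1 A2" for A1 A2
    using m_core_EP_unique[OF n that P] by (rule conjI)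
  show ?thesis
  proof (intro conjI allI impI)
    show "\<exists>A1 A2. m_core_EP_decomposition n k A A1 A2"
      using m_core_EP_exists[OF n A k ind P] by blast
  next
    fix A1 A2 U T S N G1 G2 G3 G4
    assume dec: "m_core_EP_decomposition n k A A1 A2"
      and core: "core_EP_decomposition n k r A U T S N \<and>
         G1 \<in> carrier_mat r r \<and> G2 \<in> carrier_mat r (n - r) \<and>
         G3 \<in> carrier_mat (n - r) r \<and> G4 \<in> carrier_mat (n - r) (n - r) \<and>
         mat_adjoint U * minkowski_metric n * U = four_block_mat G1 G2 G3 G4"
    show "\<exists>G1inv. mat_inverse G1 = Some G1inv \<and>
            A1 = U * four_block_mat T (S + G1inv * G2 * N)
                       (0\<^sub>m (n - r) r) (0\<^sub>m (n - r) (n - r)) * mat_adjoint U \<and>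
            A2 = U * four_block_mat (0\<^sub>m r r) (- (G1inv * G2 * N))
                       (0\<^sub>m (n - r) r) N * mat_adjoint U"
      unfolding unique[OF dec, THEN conjunct1] unique[OF dec, THEN conjunct2]
      using core by (intro m_core_EP_block_form[OF n r P]) blast+
  qed
qed

end
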